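(* Let $\theta$ be an action of an inverse semigroup $S$ on a locally compact Hausdorff space $X$. The following hold. (i) The continuous map $\iota_X\colon X\to X^{\mathrm{KS}}$ is $S$-equivariant and satisfies $\iota_X(X_e)=X^{\mathrm{KS}}_e\cap\iota_X(X)$ for each $e\in E(S)$. (ii) The continuous map $p_X\colon X^{\mathrm{KS}}\to X$ is $S$-equivariant.
   Context: An inverse semigroup is a semigroup $S$ in which every $s$ has a unique $s^*$ with $ss^*s=s$, $s^*ss^*=s^*$; $E(S)$ is its commutative subsemigroup of idempotents; $s\le t$ means $ts^*s=s$. An action $\theta$ of $S$ on a topological space $X$ is a semigroup homomorphism $s\mapsto\theta_s$ from $S$ to the inverse semigroup of partial bijections of $X$ (bijections between subsets, composed on the largest possible domain) such that, writing $X_e$ for the subset on which $\theta_e$ ($e\in E(S)$) is the identity (so $\theta_s$ is a bijection $X_{s^*s}\to X_{ss^*}$): each $X_e$ is open, each $\theta_s\colon X_{s^*s}\to X_{ss^*}$ is continuous, and $\bigcup_{e\in E(S)}X_e=X$. A map $f\colon Y\to X$ between spaces with $S$-actions $\sigma,\theta$ is $S$-equivariant if $f(Y_e)\subset X_e$ for all $e\in E(S)$ and $f(\sigma_s(y))=\theta_s(f(y))$ for all $s\in S$, $y\in Y_{s^*s}$. The space $X^{\mathrm{KS}}$: let $\widetilde{X_e}=X_e\sqcup\{\infty_e\}$ be the one-point compactification of $X_e$ (a point $\infty_e$ is added even when $X_e$ is compact). Let $\widetilde{X^{\mathrm{KS}}}$ be the set of $\tau\in\prod_{e\in E(S)}\widetilde{X_e}$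 such that (1) if $e_1\le e_2$ and $\tau(e_1)\ne\infty_{e_1}$, then $\tau(e_2)=\tau(e_1)$; (2) if $\tau(e_1)\neq\infty_{e_1}$ and $\tau(e_2)\neq\infty_{e_2}$, then $\tau(e_1e_2)\neq\infty_{e_1e_2}$; with the topology induced from the product topology. Set $X^{\mathrm{KS}}=\widetilde{X^{\mathrm{KS}}}\setminus\{\infty\}$, $\infty=(\infty_e)_e$. $S$ acts on $X^{\mathrm{KS}}$ by $X^{\mathrm{KS}}_e=\{\tau\in X^{\mathrm{KS}}\mid\tau(e)\ne\infty_e\}$ and $\theta^{\mathrm{KS}}_s\colon X^{\mathrm{KS}}_{s^*s}\to X^{\mathrm{KS}}_{ss^*}$, $\theta^{\mathrm{KS}}_s(\tau)(e)=\theta_{es}(\tau(s^*es))$ if $\tau(s^*es)\neq\infty_{s^*es}$ and $\infty_e$ otherwise. The continuous map $\iota_X\colon X\to X^{\mathrm{KS}}$ sends $x$ to $\tau_x$, where $\tau_x(e)=x$ if $x\in X_e$ and $\infty_e$ otherwise. The continuous map $p_X\colon X^{\mathrm{KS}}\to X$ is $p_X(\tau)=\tau(e)$ for any $e\in E(S)$ with $\tau(e)\neq\infty_e$ (independent of the choice of $e$). *)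

theory Defs
  imports "HOL-Analysis.Analysis"
begin

class inverse_semigroup = semigroup_mult +
  assumes ex1_star: "\<exists>!t. s * t * s = s \<and> t * s * t = t"

definition star :: "'s::inverse_semigroup \<Rightarrow> 's"
  where "star s = (THE t. s * t * s = s \<and> t * s * t = t)"

definition idems :: "'s::inverse_semigroup set"
  where "idems = {e. e * e = e}"

text \<open>The natural partial order \<open>s \<le> t\<close>.\<close>

definition sg_le :: "'s::inverse_semigroup \<Rightarrow> 's \<Rightarrow> bool"
  where "sg_le s t \<longleftrightarrow> t * star s * s = s"

lemma star_props: "s * star s * s = s" "star s * s * star s = star s"
  using theI'[OF ex1_star[of s]] unfolding star_def by auto

lemma star_unique: "s * t * s = s \<Longrightarrow> t * s * t = t \<Longrightarrow> star s = t"
  using ex1_star[of s] star_props[of s] by blast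

lemma star_star: "star (star s) = s"
  by (rule star_unique) (simp_all add: star_props)

lemma star_idem: "e \<in> idems \<Longrightarrow> star e = e"
  by (rule star_unique) (simp_all add: idems_def)

lemma idems_mult:
  assumes e: "e \<in> idems" and f: "f \<in> idems" shows "e * f \<in> idems"
proof -
  have ee: "e * e = e" "f * f = f" using e f by (auto simp: idems_def)
  have ee': "e * (e * a) = e * a" "f * (f * a) = f * a" for a
    using ee by (simp_all flip: mult.assoc)
  define x where "x = star (e * f)"
  have x1: "e * (f * (x * (e * f))) = e * f" and x2: "x * (e * (f * x)) = x"
    using star_props[of "e * f"] by (simp_all add: x_def mult.assoc)
  have x2': "x * (e * (f * (x * a))) = x * a" for a
    using x2 by (metis mult.assoc)
  have "star (e * f) = f * x * e"
    by (rule star_unique) (simp_all add: mult.assoc ee ee' x1 x2')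
  hence fxe: "x = f * x * e" by (simp add: x_def)
  have "x * x = (f * x * e) * (f * x * e)" using fxe by simp
  also have "\<dots> = f * (x * (e * (f * (x * e))))" by (simp add: mult.assoc)
  also have "\<dots> = f * x * e" by (simp add: x2' mult.assoc)
  also have "\<dots> = x" using fxe by simp
  finally have "x \<in> idems" by (simp add: idems_def)
  hence "star x = x" by (rule star_idem)
  thus ?thesis using \<open>x \<in> idems\<close> by (simp add: x_def star_star)
qed

lemma idems_commute:
  assumes e: "e \<in> idems" and f: "f \<in> idems" shows "e * f = f * e"
proof -
  have ee: "e * e = e" "f * f = f" using e f by (auto simp: idems_def)
  have ee': "e * (e * a) = e * a" "f * (f * a) = f * a" for a
    using ee by (simp_all flip: mult.assoc)
  have ef: "e * (f * (e * f)) = e * f" "f * (e * (f * e)) = f * e"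
    using idems_mult[OF e f] idems_mult[OF f e] by (simp_all add: idems_def mult.assoc)
  have "star (e * f) = f * e"
    by (rule star_unique) (simp_all add: mult.assoc ee' ef)
  thus ?thesis using star_idem[OF idems_mult[OF e f]] by simp
qed

lemma star_mult_idem: "star s * s \<in> idems" "s * star s \<in> idems"
  using star_props[of s] by (simp_all add: idems_def flip: mult.assoc)

lemma star_mult: "star (s * t) = star t * star s"
proof (rule star_unique)
  have c: "t * star t * (star s * s) = star s * s * (t * star t)"
    by (intro idems_commute star_mult_idem)
  have "s * t * (star t * star s) * (s * t) = s * (t * star t * (star s * s)) * t"
    by (simp add: mult.assoc)
  also have "\<dots> = (s * star s * s) * (t * star t * t)"
    by (subst c) (simp add: mult.assoc)
  finally show "s * t * (star t * star s) * (s * t) = s * t" by (simp add: star_props)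
  have "star t * star s * (s * t) * (star t * star s) = star t * (star s * s * (t * star t)) * star s"
    by (simp add: mult.assoc)
  also have "\<dots> = (star t * t * star t) * (star s * s * star s)"
    by (subst c[symmetric]) (simp add: mult.assoc)
  finally show "star t * star s * (s * t) * (star t * star s) = star t * star s"
    by (simp add: star_props)
qed

lemma conj_mult:
  assumes "e \<in> idems" "f \<in> idems"
  shows "(star s * e * s) * (star s * f * s) = star s * (e * f) * s"
proof -
  have "(star s * e * s) * (star s * f * s) = star s * (e * (s * star s)) * f * s"
    by (simp add: mult.assoc)
  also have "\<dots> = (star s * s * star s) * (e * f) * s"
    by (simp add: idems_commute[OF assms(1) star_mult_idem(2)] mult.assoc)
  finally show ?thesis by (simp add: star_props)
qed

lemma conj_idem: "e \<in> idems \<Longrightarrow> star s * e * s \<in> idems"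
  using conj_mult[of e e s] by (simp add: idems_def)

lemma sg_le_idems: "e \<in> idems \<Longrightarrow> sg_le e f \<longleftrightarrow> f * e = e"
  by (simp add: sg_le_def star_idem mult.assoc) (simp add: idems_def)

text \<open>Partial maps are functions of type \<open>'x \<rightharpoonup> 'x\<close>; the library composition
  \<open>\<circ>\<^sub>m\<close> is the composition on the largest possible domain.\<close>

definition partial_bij :: "'x set \<Rightarrow> ('x \<rightharpoonup> 'x) \<Rightarrow> bool"
  where "partial_bij A g \<longleftrightarrow> dom g \<subseteq> A \<and> ran g \<subseteq> A \<and> inj_on g (dom g)"

text \<open>For idempotent \<open>e\<close>, this is \<open>X\<^sub>e\<close>.\<close>

definition act_dom :: "('s::inverse_semigroup \<Rightarrow> 'x \<rightharpoonup> 'x) \<Rightarrow> 's \<Rightarrow> 'x set"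
  where "act_dom \<theta> e = {x. \<theta> e x = Some x}"

definition sg_action :: "'x topology \<Rightarrow> ('s::inverse_semigroup \<Rightarrow> 'x \<rightharpoonup> 'x) \<Rightarrow> bool"
  where "sg_action X \<theta> \<longleftrightarrow>
    (\<forall>s. partial_bij (topspace X) (\<theta> s)) \<and>
    (\<forall>s t. \<theta> (s * t) = \<theta> s \<circ>\<^sub>m \<theta> t) \<and>
    (\<forall>e\<in>idems. openin X (act_dom \<theta> e)) \<and>
    (\<forall>s. continuous_map (subtopology X (act_dom \<theta> (star s * s)))
                        (subtopology X (act_dom \<theta> (s * star s))) (\<lambda>x. the (\<theta> s x))) \<and>
    (\<Union>e\<in>idems. act_dom \<theta> e) = topspace X"

definition equivariant ::
    "'y topology \<Rightarrow> ('s::inverse_semigroup \<Rightarrow> 'y \<rightharpoonup> 'y) \<Rightarrow>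
     'x topology \<Rightarrow> ('s \<Rightarrow> 'x \<rightharpoonup> 'x) \<Rightarrow> ('y \<Rightarrow> 'x) \<Rightarrow> bool"
  where "equivariant Y \<sigma> X \<theta> f \<longleftrightarrow>
    sg_action Y \<sigma> \<and> sg_action X \<theta> \<and> f \<in> topspace Y \<rightarrow> topspace X \<and>
    (\<forall>e\<in>idems. f ` act_dom \<sigma> e \<subseteq> act_dom \<theta> e) \<and>
    (\<forall>s. \<forall>y\<in>act_dom \<sigma> (star s * s). f (the (\<sigma> s y)) = the (\<theta> s (f y)))"

text \<open>The one-point compactification of \<open>X\<^sub>e\<close> is the library's
  \<^const>\<open>Alexandroff_compactification\<close>, which adds the point \<^const>\<open>None\<close> (playing
  the role of \<open>\<infinity>\<^sub>e\<close>) even when \<open>X\<^sub>e\<close> is compact. Points of the product over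
  \<^const>\<open>idems\<close> are extensional functions, i.e. equal to \<^const>\<open>undefined\<close> off \<^const>\<open>idems\<close>.\<close>

definition KS_product :: "'x topology \<Rightarrow> ('s::inverse_semigroup \<Rightarrow> 'x \<rightharpoonup> 'x) \<Rightarrow> ('s \<Rightarrow> 'x option) topology"
  where "KS_product X \<theta> =
    product_topology (\<lambda>e. Alexandroff_compactification (subtopology X (act_dom \<theta> e))) idems"

definition KS_tilde :: "'x topology \<Rightarrow> ('s::inverse_semigroup \<Rightarrow> 'x \<rightharpoonup> 'x) \<Rightarrow> ('s \<Rightarrow> 'x option) set"
  where "KS_tilde X \<theta> = {\<tau> \<in> topspace (KS_product X \<theta>).
    (\<forall>e1\<in>idems. \<forall>e2\<in>idems. sg_le e1 e2 \<and> \<tau> e1 \<noteq> None \<longrightarrow> \<tau> e2 = \<tau> e1) \<and>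
    (\<forall>e1\<in>idems. \<forall>e2\<in>idems. \<tau> e1 \<noteq> None \<and> \<tau> e2 \<noteq> None \<longrightarrow> \<tau> (e1 * e2) \<noteq> None)}"

definition KS_infty :: "'s::inverse_semigroup \<Rightarrow> 'x option"
  where "KS_infty = (\<lambda>e\<in>idems. None)"

definition KS_space :: "'x topology \<Rightarrow> ('s::inverse_semigroup \<Rightarrow> 'x \<rightharpoonup> 'x) \<Rightarrow> ('s \<Rightarrow> 'x option) topology"
  where "KS_space X \<theta> = subtopology (KS_product X \<theta>) (KS_tilde X \<theta> - {KS_infty})"

definition KS_dom :: "'x topology \<Rightarrow> ('s::inverse_semigroup \<Rightarrow> 'x \<rightharpoonup> 'x) \<Rightarrow> 's \<Rightarrow> ('s \<Rightarrow> 'x option) set"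
  where "KS_dom X \<theta> e = {\<tau> \<in> topspace (KS_space X \<theta>). \<tau> e \<noteq> None}"

definition KS_action ::
    "'x topology \<Rightarrow> ('s::inverse_semigroup \<Rightarrow> 'x \<rightharpoonup> 'x) \<Rightarrow> 's \<Rightarrow> ('s \<Rightarrow> 'x option) \<rightharpoonup> ('s \<Rightarrow> 'x option)"
  where "KS_action X \<theta> s \<tau> =
    (if \<tau> \<in> KS_dom X \<theta> (star s * s)
     then Some (\<lambda>e\<in>idems. case \<tau> (star s * e * s) of
                              None \<Rightarrow> None
                            | Some x \<Rightarrow> Some (the (\<theta> (e * s) x)))
     else None)"

definition KS_iota :: "('s::inverse_semigroup \<Rightarrow> 'x \<rightharpoonup> 'x) \<Rightarrow> 'x \<Rightarrow> 's \<Rightarrow> 'x option"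
  where "KS_iota \<theta> x = (\<lambda>e\<in>idems. if x \<in> act_dom \<theta> e then Some x else None)"

text \<open>On \<open>X\<^sup>K\<^sup>S\<close> the described point exists uniquely; see \<open>KS_proj_eq\<close> below.\<close>

definition KS_proj :: "('s::inverse_semigroup \<Rightarrow> 'x option) \<Rightarrow> 'x"
  where "KS_proj \<tau> = (THE x. \<exists>e\<in>idems. \<tau> e = Some x)"

lemma sg_action_mult:
  assumes "sg_action X \<theta>"
  shows "\<theta> (s * t) x = Some z \<longleftrightarrow> (\<exists>y. \<theta> t x = Some y \<and> \<theta> s y = Some z)"
  using assms by (auto simp: sg_action_def map_comp_Some_iff)

lemma sg_action_inj:
  assumes "sg_action X \<theta>" "\<theta> s x = Some z" "\<theta> s y = Some z"
  shows "x = y"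
proof -
  have "inj_on (\<theta> s) (dom (\<theta> s))" using assms(1) by (simp add: sg_action_def partial_bij_def)
  thus ?thesis using assms(2,3) unfolding inj_on_def dom_def by simp
qed

lemma sg_action_idem:
  assumes "sg_action X \<theta>" "e \<in> idems" "\<theta> e x = Some y"
  shows "y = x"
proof -
  have "\<theta> (e * e) x = Some y" using assms by (simp add: idems_def)
  then obtain w where "\<theta> e x = Some w" "\<theta> e w = Some y"
    using sg_action_mult[OF assms(1)] by blast
  thus ?thesis using sg_action_inj[OF assms(1)] assms(3) by auto
qed

lemma sg_action_star:
  assumes A: "sg_action X \<theta>" and y: "\<theta> s x = Some y"
  shows "\<theta> (star s) y = Some x"
proof -
  have "\<theta> (s * (star s * s)) x = Some y" using y star_props(1)[of s] by (simp add: mult.assoc)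
  then obtain w where "\<theta> (star s * s) x = Some w"
    using sg_action_mult[OF A] by blast
  hence "\<theta> (star s * s) x = Some x"
    using sg_action_idem[OF A star_mult_idem(1)] by blast
  thus ?thesis using y sg_action_mult[OF A] by auto
qed

lemma act_dom_star:
  assumes A: "sg_action X \<theta>"
  shows "x \<in> act_dom \<theta> (star s * s) \<longleftrightarrow> (\<exists>y. \<theta> s x = Some y)"
  using sg_action_mult[OF A] sg_action_star[OF A] unfolding act_dom_def by blast

lemma act_dom_conj:
  assumes A: "sg_action X \<theta>" and e: "e \<in> idems"
  shows "x \<in> act_dom \<theta> (star s * e * s) \<longleftrightarrow> (\<exists>y. \<theta> s x = Some y \<and> y \<in> act_dom \<theta> e)"
proof
  assume "x \<in> act_dom \<theta> (star s * e * s)"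
  hence "\<theta> (star s * (e * s)) x = Some x" by (simp add: act_dom_def mult.assoc)
  then obtain y z where y: "\<theta> s x = Some y" "\<theta> e y = Some z"
    unfolding sg_action_mult[OF A] by blast
  thus "\<exists>y. \<theta> s x = Some y \<and> y \<in> act_dom \<theta> e"
    using sg_action_idem[OF A e y(2)] by (simp add: act_dom_def)
next
  assume "\<exists>y. \<theta> s x = Some y \<and> y \<in> act_dom \<theta> e"
  then obtain y where y: "\<theta> s x = Some y" "\<theta> e y = Some y" by (auto simp: act_dom_def)
  hence "\<theta> (star s * (e * s)) x = Some x"
    unfolding sg_action_mult[OF A] using sg_action_star[OF A y(1)] by blast
  thus "x \<in> act_dom \<theta> (star s * e * s)" by (simp add: act_dom_def mult.assoc)
qed

lemma sg_action_topspace: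
  assumes A: "sg_action X \<theta>" and y: "\<theta> s x = Some y"
  shows "x \<in> topspace X" "y \<in> topspace X"
proof -
  have "dom (\<theta> s) \<subseteq> topspace X" "ran (\<theta> s) \<subseteq> topspace X"
    using A by (auto simp: sg_action_def partial_bij_def)
  thus "x \<in> topspace X" "y \<in> topspace X" using y by (auto simp: dom_def ran_def)
qed

text \<open>A point of \<open>X\<^sup>K\<^sup>S\<close> amounts to a point \<open>x\<close> of \<open>X\<close> together with a filter \<open>F\<close> of
  idempotents \<open>e\<close> with \<open>x \<in> X\<^sub>e\<close>; this is only used in proofs.\<close>

definition KS_pair :: "('s::inverse_semigroup \<Rightarrow> 'x \<rightharpoonup> 'x) \<Rightarrow> 'x \<Rightarrow> 's set \<Rightarrow> bool"
  where "KS_pair \<theta> x F \<longleftrightarrow> F \<subseteq> idems \<and> F \<noteq> {} \<and>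
    (\<forall>e\<in>F. \<forall>f\<in>idems. f * e = e \<longrightarrow> f \<in> F) \<and> (\<forall>e\<in>F. \<forall>f\<in>F. e * f \<in> F) \<and>
    (\<forall>e\<in>F. x \<in> act_dom \<theta> e)"

definition KS_point :: "'x \<Rightarrow> 's::inverse_semigroup set \<Rightarrow> 's \<Rightarrow> 'x option"
  where "KS_point x F = (\<lambda>e\<in>idems. if e \<in> F then Some x else None)"

lemma KS_product_topspace:
  assumes A: "sg_action X \<theta>"
  shows "topspace (KS_product X \<theta>) = (\<Pi>\<^sub>E e\<in>idems. insert None (Some ` act_dom \<theta> e))"
proof -
  have "act_dom \<theta> e \<subseteq> topspace X" for e
    using sg_action_topspace[OF A] by (auto simp: act_dom_def)
  thus ?thesis by (simp add: KS_product_def Int_absorb1)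
qed

lemma KS_space_topspace: "topspace (KS_space X \<theta>) = KS_tilde X \<theta> - {KS_infty}"
  by (auto simp: KS_space_def KS_tilde_def)

lemma KS_space_iff:
  assumes A: "sg_action X \<theta>"
  shows "\<tau> \<in> topspace (KS_space X \<theta>) \<longleftrightarrow> (\<exists>x F. KS_pair \<theta> x F \<and> \<tau> = KS_point x F)"
proof
  assume "\<tau> \<in> topspace (KS_space X \<theta>)"
  hence \<tau>: "\<tau> \<in> KS_tilde X \<theta>" "\<tau> \<noteq> KS_infty" by (auto simp: KS_space_topspace)
  have PE: "\<tau> \<in> (\<Pi>\<^sub>E e\<in>idems. insert None (Some ` act_dom \<theta> e))"
    using \<tau>(1) KS_product_topspace[OF A] by (auto simp: KS_tilde_def)
  have up: "\<tau> f = Some x" if "e \<in> idems" "f \<in> idems" "f * e = e" "\<tau> e = Some x" for e f x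
  proof -
    have "\<forall>e1\<in>idems. \<forall>e2\<in>idems. sg_le e1 e2 \<and> \<tau> e1 \<noteq> None \<longrightarrow> \<tau> e2 = \<tau> e1"
      using \<tau>(1) unfolding KS_tilde_def by blast
    moreover have "sg_le e f" using that by (simp add: sg_le_idems)
    moreover have "\<tau> e \<noteq> None" using that(4) by simp
    ultimately have "\<tau> f = \<tau> e" using that(1,2) by blast
    thus ?thesis using that(4) by simp
  qed
  have mul: "\<tau> (e * f) \<noteq> None" if "e \<in> idems" "f \<in> idems" "\<tau> e \<noteq> None" "\<tau> f \<noteq> None" for e f
  proof -
    have "\<forall>e1\<in>idems. \<forall>e2\<in>idems. \<tau> e1 \<noteq> None \<and> \<tau> e2 \<noteq> None \<longrightarrow> \<tau> (e1 * e2) \<noteq> None"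
      using \<tau>(1) unfolding KS_tilde_def by blast
    thus ?thesis using that by simp
  qed
  define F where "F = {e \<in> idems. \<tau> e \<noteq> None}"
  have "F \<noteq> {}"
  proof
    assume "F = {}"
    hence "\<tau> = KS_infty" using PE by (auto simp: F_def KS_infty_def fun_eq_iff PiE_def extensional_def)
    thus False using \<tau>(2) by simp
  qed
  then obtain e0 x where e0: "e0 \<in> idems" "\<tau> e0 = Some x" by (auto simp: F_def)
  have x: "\<tau> e = Some x" if "e \<in> F" for e
  proof -
    have e: "e \<in> idems" "\<tau> e \<noteq> None" using that by (auto simp: F_def)
    obtain z where z: "\<tau> (e * e0) = Some z" using mul[of e e0] e e0 by auto
    have i: "e * e0 \<in> idems" using idems_mult e e0 by blast
    have "e * (e * e0) = e * e0" using e by (simp add: idems_def flip: mult.assoc)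
    moreover have "e0 * (e * e0) = e * e0"
      using idems_commute[OF e(1) e0(1)] e0(1) by (simp add: idems_def flip: mult.assoc)
    ultimately show ?thesis using up[OF i e(1) _ z] up[OF i e0(1) _ z] e0(2) by simp
  qed
  have "KS_pair \<theta> x F"
    unfolding KS_pair_def
  proof (intro conjI ballI impI)
    show "e * f \<in> F" if "e \<in> F" "f \<in> F" for e f
      using that mul[of e f] idems_mult[of e f] by (auto simp: F_def)
    show "x \<in> act_dom \<theta> e" if "e \<in> F" for e
      using that x[OF that] PE by (force simp: F_def PiE_iff)
    show "f \<in> F" if "e \<in> F" "f \<in> idems" "f * e = e" for e f
      using that up[of e f x] x[OF that(1)] by (auto simp: F_def)
  qed (use \<open>F \<noteq> {}\<close> in \<open>auto simp: F_def\<close>)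
  moreover have "\<tau> = KS_point x F"
  proof
    fix e show "\<tau> e = KS_point x F e"
      using x[of e] PE by (cases "e \<in> idems") (auto simp: KS_point_def F_def PiE_def extensional_def)
  qed
  ultimately show "\<exists>x F. KS_pair \<theta> x F \<and> \<tau> = KS_point x F" by blast
next
  assume "\<exists>x F. KS_pair \<theta> x F \<and> \<tau> = KS_point x F"
  then obtain x F where P: "KS_pair \<theta> x F" and \<tau>: "\<tau> = KS_point x F" by blast
  obtain e where "e \<in> F" "e \<in> idems" using P by (auto simp: KS_pair_def)
  hence "\<tau> e \<noteq> KS_infty e" by (simp add: \<tau> KS_point_def KS_infty_def)
  hence "\<tau> \<noteq> KS_infty" by auto
  moreover have "\<tau> \<in> KS_tilde X \<theta>"
    using P unfolding KS_tilde_def KS_product_topspace[OF A] \<tau> KS_pair_def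
    by (auto simp: KS_point_def sg_le_idems idems_mult split: if_splits)
  ultimately show "\<tau> \<in> topspace (KS_space X \<theta>)" by (simp add: KS_space_topspace)
qed

lemma KS_point_inject:
  assumes "KS_pair \<theta> x F" "KS_pair \<theta> y G" "KS_point x F = KS_point y G"
  shows "x = y \<and> F = G"
proof -
  have 1: "e \<in> idems \<Longrightarrow> (if e \<in> F then Some x else None) = (if e \<in> G then Some y else None)" for e
    using fun_cong[OF assms(3), of e] by (simp add: KS_point_def)
  have "F \<subseteq> idems" "G \<subseteq> idems" "F \<noteq> {}" using assms by (auto simp: KS_pair_def)
  hence FG: "F = G" using 1 by (metis option.distinct(1) subsetD subset_antisym subsetI)
  obtain e where "e \<in> F" using \<open>F \<noteq> {}\<close> by blast
  thus ?thesis using 1[of e] FG \<open>F \<subseteq> idems\<close> by auto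
qed

lemma KS_proj_eq:
  assumes A: "sg_action X \<theta>" and \<tau>: "\<tau> \<in> topspace (KS_space X \<theta>)"
    and e: "e \<in> idems" "\<tau> e \<noteq> None"
  shows "\<tau> e = Some (KS_proj \<tau>)"
proof -
  obtain x F where P: "KS_pair \<theta> x F" "\<tau> = KS_point x F" using \<tau> KS_space_iff[OF A] by blast
  have x: "\<tau> e = Some x" using e P by (simp add: KS_point_def split: if_splits)
  have "KS_proj \<tau> = x" unfolding KS_proj_def
    by (rule the_equality) (use x e P in \<open>auto simp: KS_point_def split: if_splits\<close>)
  thus ?thesis using x by simp
qed

lemma KS_dom_point:
  assumes A: "sg_action X \<theta>" and P: "KS_pair \<theta> x F" and e: "e \<in> idems"
  shows "KS_point x F \<in> KS_dom X \<theta> e \<longleftrightarrow> e \<in> F"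
  using KS_space_iff[OF A] P e by (auto simp: KS_dom_def KS_point_def)

definition KS_push :: "'s::inverse_semigroup \<Rightarrow> 's set \<Rightarrow> 's set"
  where "KS_push s F = {e \<in> idems. star s * e * s \<in> F}"

lemma KS_push_pair:
  assumes A: "sg_action X \<theta>" and P: "KS_pair \<theta> x F" and s: "star s * s \<in> F"
  shows "KS_pair \<theta> (the (\<theta> s x)) (KS_push s F)"
  unfolding KS_pair_def
proof (intro conjI ballI impI)
  show "KS_push s F \<subseteq> idems" by (auto simp: KS_push_def)
  have "star s * (s * star s) * s = star s * s"
    using star_props(2)[of s] by (simp flip: mult.assoc)
  hence "s * star s \<in> KS_push s F" using s star_mult_idem(2) by (simp add: KS_push_def)
  thus "KS_push s F \<noteq> {}" by blast
  show "f \<in> KS_push s F" if "e \<in> KS_push s F" "f \<in> idems" "f * e = e" for e f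
  proof -
    have e: "e \<in> idems" "star s * e * s \<in> F" using that by (auto simp: KS_push_def)
    have "(star s * f * s) * (star s * e * s) = star s * e * s"
      using conj_mult[OF that(2) e(1)] that(3) by simp
    thus ?thesis using P e that(2) conj_idem[OF that(2), of s]
      unfolding KS_pair_def KS_push_def by blast
  qed
  show "e * f \<in> KS_push s F" if "e \<in> KS_push s F" "f \<in> KS_push s F" for e f
  proof -
    have e: "e \<in> idems" "star s * e * s \<in> F" "f \<in> idems" "star s * f * s \<in> F"
      using that by (auto simp: KS_push_def)
    hence "(star s * e * s) * (star s * f * s) \<in> F" using P unfolding KS_pair_def by blast
    thus ?thesis using conj_mult[OF e(1,3), of s] idems_mult[OF e(1,3)] by (simp add: KS_push_def)
  qed
  show "the (\<theta> s x) \<in> act_dom \<theta> e" if "e \<in> KS_push s F" for e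
    using that P act_dom_conj[OF A, of e x s] by (auto simp: KS_push_def KS_pair_def)
qed

lemma KS_action_point:
  assumes A: "sg_action X \<theta>" and P: "KS_pair \<theta> x F"
  shows "KS_action X \<theta> s (KS_point x F) =
    (if star s * s \<in> F then Some (KS_point (the (\<theta> s x)) (KS_push s F)) else None)"
proof (cases "star s * s \<in> F")
  case True
  hence "KS_point x F \<in> KS_dom X \<theta> (star s * s)"
    using KS_dom_point[OF A P star_mult_idem(1)] by blast
  moreover have "(case KS_point x F (star s * e * s) of None \<Rightarrow> None | Some x \<Rightarrow> Some (the (\<theta> (e * s) x)))
      = KS_point (the (\<theta> s x)) (KS_push s F) e" if e: "e \<in> idems" for e
  proof (cases "star s * e * s \<in> F")
    case T: True
    hence "x \<in> act_dom \<theta> (star s * e * s)" using P by (auto simp: KS_pair_def)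
    then obtain y where "\<theta> s x = Some y" "\<theta> e y = Some y"
      using act_dom_conj[OF A e] by (auto simp: act_dom_def)
    hence "\<theta> (e * s) x = Some y" "\<theta> s x = Some y" using sg_action_mult[OF A] by auto
    thus ?thesis using T e by (simp add: KS_point_def KS_push_def conj_idem)
  next
    case False
    thus ?thesis using e by (simp add: KS_point_def KS_push_def conj_idem)
  qed
  ultimately show ?thesis using True
    by (auto simp: KS_action_def restrict_def fun_eq_iff) (auto simp: KS_point_def)
next
  case False
  thus ?thesis using KS_dom_point[OF A P star_mult_idem(1)] by (simp add: KS_action_def)
qed

lemma KS_action_notin: "\<tau> \<notin> topspace (KS_space X \<theta>) \<Longrightarrow> KS_action X \<theta> s \<tau> = None"
  by (simp add: KS_action_def KS_dom_def)

lemma KS_push_idem: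
  assumes P: "KS_pair \<theta> x F" and e: "e \<in> F"
  shows "KS_push e F = F"
proof -
  have ei: "e \<in> idems" and F: "F \<subseteq> idems" using e P by (auto simp: KS_pair_def)
  have "f \<in> F \<longleftrightarrow> e * f * e \<in> F" if f: "f \<in> idems" for f
  proof
    show "f \<in> F \<Longrightarrow> e * f * e \<in> F" using P e by (auto simp: KS_pair_def)
    have "f * (e * f * e) = (f * e) * (f * e)" by (simp add: mult.assoc)
    also have "\<dots> = f * e" using idems_mult[OF f ei] by (simp add: idems_def)
    also have "\<dots> = f * (e * e)" using ei by (simp add: idems_def)
    also have "\<dots> = e * f * e"
      using idems_commute[OF f ei] by (simp flip: mult.assoc)
    finally show "e * f * e \<in> F \<Longrightarrow> f \<in> F" using P f unfolding KS_pair_def by blast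
  qed
  thus ?thesis using F by (auto simp: KS_push_def star_idem[OF ei])
qed

lemma KS_act_dom:
  assumes A: "sg_action X \<theta>" and e: "e \<in> idems"
  shows "act_dom (KS_action X \<theta>) e = KS_dom X \<theta> e"
proof (intro set_eqI iffI)
  have ee: "star e * e = e" using e star_idem[OF e] by (simp add: idems_def)
  fix \<tau>
  show "\<tau> \<in> KS_dom X \<theta> e" if "\<tau> \<in> act_dom (KS_action X \<theta>) e"
    using that by (auto simp: act_dom_def KS_action_def ee split: if_splits)
  assume d: "\<tau> \<in> KS_dom X \<theta> e"
  then obtain x F where P: "KS_pair \<theta> x F" and \<tau>: "\<tau> = KS_point x F"
    using KS_space_iff[OF A] by (auto simp: KS_dom_def)
  have F: "e \<in> F" using d KS_dom_point[OF A P e] \<tau> by simp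
  have "\<theta> e x = Some x" using P F by (auto simp: KS_pair_def act_dom_def)
  thus "\<tau> \<in> act_dom (KS_action X \<theta>) e"
    using KS_action_point[OF A P, of e] F by (simp add: act_dom_def \<tau> ee KS_push_idem[OF P F])
qed

lemma KS_action_mult:
  assumes A: "sg_action X \<theta>"
  shows "KS_action X \<theta> (s * t) = KS_action X \<theta> s \<circ>\<^sub>m KS_action X \<theta> t"
proof
  fix \<tau>
  show "KS_action X \<theta> (s * t) \<tau> = (KS_action X \<theta> s \<circ>\<^sub>m KS_action X \<theta> t) \<tau>"
  proof (cases "\<tau> \<in> topspace (KS_space X \<theta>)")
    case False
    thus ?thesis by (simp add: KS_action_notin map_comp_def)
  next
    case True
    then obtain x F where P: "KS_pair \<theta> x F" and \<tau>: "\<tau> = KS_point x F"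
      using KS_space_iff[OF A] by blast
    have st: "star (s * t) * (s * t) = star t * (star s * s) * t" by (simp add: star_mult mult.assoc)
    have "star t * t * (star t * (star s * s) * t) = star t * (star s * s) * t"
      using star_props(2)[of t] by (simp flip: mult.assoc)
    hence imp: "star t * (star s * s) * t \<in> F \<Longrightarrow> star t * t \<in> F"
      using P star_mult_idem(1) unfolding KS_pair_def by blast
    show ?thesis
    proof (cases "star t * t \<in> F")
      case False
      moreover have "star t * (star s * s) * t \<notin> F" using False imp by blast
      ultimately show ?thesis by (simp add: \<tau> KS_action_point[OF A P] map_comp_def st)
    next
      case tF: True
      have Q: "KS_pair \<theta> (the (\<theta> t x)) (KS_push t F)" by (rule KS_push_pair[OF A P tF])
      have iff: "star s * s \<in> KS_push t F \<longleftrightarrow> star t * (star s * s) * t \<in> F"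
        by (simp add: KS_push_def star_mult_idem)
      have push: "KS_push s (KS_push t F) = KS_push (s * t) F"
        by (auto simp: KS_push_def star_mult mult.assoc conj_idem) (metis conj_idem mult.assoc)
      have "the (\<theta> s (the (\<theta> t x))) = the (\<theta> (s * t) x)" if "star t * (star s * s) * t \<in> F"
      proof -
        have "x \<in> act_dom \<theta> (star (s * t) * (s * t))" using that P by (simp add: st KS_pair_def)
        then obtain z where "\<theta> (s * t) x = Some z" using act_dom_star[OF A] by blast
        thus ?thesis using sg_action_mult[OF A, of s t x z] by auto
      qed
      thus ?thesis
        by (simp add: \<tau> KS_action_point[OF A P] KS_action_point[OF A Q] map_comp_def st tF iff push)
    qed
  qed
qed

lemma KS_action_sg_action:
  assumes lc: "locally_compact_space X" and H: "Hausdorff_space X" and A: "sg_action X \<theta>"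
  shows "sg_action (KS_space X \<theta>) (KS_action X \<theta>)"
proof -
  let ?K = "KS_space X \<theta>" and ?A = "KS_action X \<theta>"
  let ?C = "\<lambda>e. Alexandroff_compactification (subtopology X (act_dom \<theta> e))"
  have opX: "openin X (act_dom \<theta> e)" if "e \<in> idems" for e
    using A that by (simp add: sg_action_def)
  have coord: "continuous_map ?K (?C e) (\<lambda>\<tau>. \<tau> e)" if "e \<in> idems" for e
    unfolding KS_space_def KS_product_def
    by (intro continuous_map_from_subtopology continuous_map_product_projection that)
  have op: "openin ?K {\<tau> \<in> topspace ?K. \<tau> e \<in> W}" if "e \<in> idems" "openin (?C e) W" for e W
    using openin_continuous_map_preimage[OF coord[OF that(1)] that(2)] .
  have SomeC: "openin (?C e) (Some ` V)" if "openin X V" "V \<subseteq> act_dom \<theta> e" for e V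
    using that by (simp add: openin_subtopology) blast
  have dom_eq: "KS_dom X \<theta> e = {\<tau> \<in> topspace ?K. \<tau> e \<in> Some ` act_dom \<theta> e}" if e: "e \<in> idems" for e
  proof (intro set_eqI iffI)
    fix \<tau> assume "\<tau> \<in> KS_dom X \<theta> e"
    hence \<tau>: "\<tau> \<in> topspace ?K" "\<tau> e \<noteq> None" by (auto simp: KS_dom_def)
    have "\<tau> e \<in> topspace (?C e)" using coord[OF e] \<tau>(1) by (auto simp: continuous_map_def)
    thus "\<tau> \<in> {\<tau> \<in> topspace ?K. \<tau> e \<in> Some ` act_dom \<theta> e}" using \<tau> by auto
  qed (auto simp: KS_dom_def)
  have dom_open: "openin ?K (KS_dom X \<theta> e)" if "e \<in> idems" for e
    unfolding dom_eq[OF that] by (intro op that SomeC opX order_refl)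
  have Kpb: "partial_bij (topspace ?K) (?A s)" for s
    unfolding partial_bij_def
  proof (intro conjI)
    show "dom (?A s) \<subseteq> topspace ?K" using KS_action_notin by (force simp: dom_def)
    show "ran (?A s) \<subseteq> topspace ?K"
    proof
      fix \<tau>' assume "\<tau>' \<in> ran (?A s)"
      then obtain \<tau> where \<tau>: "?A s \<tau> = Some \<tau>'" by (auto simp: ran_def)
      hence "\<tau> \<in> topspace ?K" using KS_action_notin by fastforce
      then obtain x F where P: "KS_pair \<theta> x F" and x: "\<tau> = KS_point x F"
        using KS_space_iff[OF A] by blast
      thus "\<tau>' \<in> topspace ?K"
        using \<tau> KS_push_pair[OF A P, of s] KS_space_iff[OF A]
        by (auto simp: KS_action_point[OF A P] split: if_splits)
    qed
    show "inj_on (?A s) (dom (?A s))"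
    proof (rule inj_on_inverseI[where g = "\<lambda>z. the (?A (star s) (the z))"])
      fix \<tau> assume "\<tau> \<in> dom (?A s)"
      then obtain \<tau>' where \<tau>': "?A s \<tau> = Some \<tau>'" by auto
      hence "\<tau> \<in> KS_dom X \<theta> (star s * s)" by (auto simp: KS_action_def split: if_splits)
      hence "?A (star s * s) \<tau> = Some \<tau>"
        using KS_act_dom[OF A star_mult_idem(1)] by (auto simp: act_dom_def)
      thus "the (?A (star s) (the (?A s \<tau>))) = \<tau>"
        using \<tau>' by (simp add: KS_action_mult[OF A])
    qed
  qed
  have val: "the (?A s \<tau>) \<in> KS_dom X \<theta> (s * star s)"
       "e \<in> idems \<Longrightarrow> the (?A s \<tau>) e = (if \<tau> (star s * e * s) = None then None
           else Some (the (\<theta> s (KS_proj \<tau>))))"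
       "KS_proj \<tau> \<in> act_dom \<theta> (star s * s)"
    if d: "\<tau> \<in> KS_dom X \<theta> (star s * s)" for s \<tau> e
  proof -
    have \<tau>K: "\<tau> \<in> topspace ?K" using d by (simp add: KS_dom_def)
    then obtain x F where P: "KS_pair \<theta> x F" and \<tau>: "\<tau> = KS_point x F"
      using KS_space_iff[OF A] by blast
    have F: "star s * s \<in> F" using d KS_dom_point[OF A P star_mult_idem(1)] \<tau> by simp
    have "\<tau> (star s * s) = Some x" using F by (simp add: \<tau> KS_point_def star_mult_idem)
    hence x: "KS_proj \<tau> = x" using KS_proj_eq[OF A \<tau>K star_mult_idem(1)[of s]] by simp
    have v: "?A s \<tau> = Some (KS_point (the (\<theta> s x)) (KS_push s F))"
      by (simp add: \<tau> KS_action_point[OF A P] F)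
    have "star s * (s * star s) * s = star s * s"
      using star_props(2)[of s] by (simp flip: mult.assoc)
    hence "s * star s \<in> KS_push s F" using F star_mult_idem by (simp add: KS_push_def)
    thus "the (?A s \<tau>) \<in> KS_dom X \<theta> (s * star s)"
      using v KS_dom_point[OF A KS_push_pair[OF A P F] star_mult_idem(2)] by simp
    show "e \<in> idems \<Longrightarrow> the (?A s \<tau>) e = (if \<tau> (star s * e * s) = None then None
           else Some (the (\<theta> s (KS_proj \<tau>))))"
      by (simp add: v x) (simp add: \<tau> KS_point_def KS_push_def conj_idem)
    show "KS_proj \<tau> \<in> act_dom \<theta> (star s * s)" using F P x by (simp add: KS_pair_def)
  qed
  have cont: "continuous_map (subtopology ?K (KS_dom X \<theta> (star s * s)))
      (subtopology ?K (KS_dom X \<theta> (s * star s))) (\<lambda>\<tau>. the (?A s \<tau>))" for s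
  proof -
    define d where "d = star s * s"
    define D where "D = KS_dom X \<theta> d"
    have d: "d \<in> idems" by (simp add: d_def star_mult_idem)
    have DK: "D \<subseteq> topspace ?K" by (auto simp: D_def KS_dom_def)
    have Dop: "openin ?K D" unfolding D_def by (rule dom_open[OF d])
    have proj: "\<tau> f = Some (KS_proj \<tau>)" if "\<tau> \<in> topspace ?K" "f \<in> idems" "\<tau> f \<noteq> None" for \<tau> f
      using KS_proj_eq[OF A that] .
    have pD: "\<tau> d = Some (KS_proj \<tau>)" if "\<tau> \<in> D" for \<tau>
      using that proj[of \<tau> d] d by (auto simp: D_def KS_dom_def)
    have preD: "openin ?K {\<tau> \<in> D. KS_proj \<tau> \<in> V}" if V: "openin X V" "V \<subseteq> act_dom \<theta> d" for V
    proof -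
      have "{\<tau> \<in> D. KS_proj \<tau> \<in> V} = D \<inter> {\<tau> \<in> topspace ?K. \<tau> d \<in> Some ` V}"
        using DK by (auto simp: pD)
      thus ?thesis using openin_Int[OF Dop op[OF d SomeC[OF V]]] by simp
    qed
    have conts: "continuous_map (subtopology X (act_dom \<theta> d)) X (\<lambda>x. the (\<theta> s x))"
      using A by (auto simp: sg_action_def d_def continuous_map_in_subtopology)
    have preX: "openin X {x \<in> act_dom \<theta> d. the (\<theta> s x) \<in> U}" if "openin X U" for U
    proof -
      have "openin (subtopology X (act_dom \<theta> d)) {x \<in> topspace (subtopology X (act_dom \<theta> d)). the (\<theta> s x) \<in> U}"
        by (rule openin_continuous_map_preimage[OF conts that])
      moreover have "act_dom \<theta> d \<subseteq> topspace X" using opX[OF d] openin_subset by blast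
      ultimately show ?thesis
        using opX[OF d] by (simp add: openin_open_subtopology Int_absorb1)
    qed
    have c1: "continuous_map (subtopology ?K D) (?C e) (\<lambda>\<tau>. the (?A s \<tau>) e)" if e: "e \<in> idems" for e
    proof -
      define c where "c = star s * e * s"
      have c: "c \<in> idems" by (simp add: c_def conj_idem e)
      have cd: "d * c = c" unfolding c_def d_def
        using star_props(2)[of s] by (simp flip: mult.assoc)
      have v: "the (?A s \<tau>) e = (if \<tau> c = None then None else Some (the (\<theta> s (KS_proj \<tau>))))"
        if "\<tau> \<in> D" for \<tau>
        using val(2)[of \<tau> s e] that e by (simp add: D_def d_def c_def)
      have cdom: "x \<in> act_dom \<theta> c \<longleftrightarrow> x \<in> act_dom \<theta> d \<and> the (\<theta> s x) \<in> act_dom \<theta> e" for x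
        using act_dom_conj[OF A e, of x s] act_dom_star[OF A, of x s] by (auto simp: c_def d_def)
      have projc: "KS_proj \<tau> \<in> act_dom \<theta> c" if "\<tau> \<in> D" "\<tau> c \<noteq> None" for \<tau>
      proof -
        have K: "\<tau> \<in> topspace ?K" using that DK by blast
        hence "\<tau> \<in> KS_dom X \<theta> c" using that by (simp add: KS_dom_def)
        hence "\<tau> c \<in> Some ` act_dom \<theta> c" using dom_eq[OF c] by blast
        thus ?thesis using proj[OF K c that(2)] by auto
      qed
      have pd: "KS_proj \<tau> \<in> act_dom \<theta> d" if "\<tau> \<in> D" for \<tau>
        using val(3)[of \<tau> s] that by (simp add: D_def d_def)
      have opc: "openin ?K {\<tau> \<in> D. \<tau> c \<noteq> None}"
      proof -
        have "{\<tau> \<in> D. \<tau> c \<noteq> None} = D \<inter> KS_dom X \<theta> c" using DK by (auto simp: KS_dom_def)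
        thus ?thesis using openin_Int[OF Dop dom_open[OF c]] by simp
      qed
      show ?thesis
        unfolding continuous_map_def
      proof (intro conjI allI impI)
        have "act_dom \<theta> e \<subseteq> topspace X" using opX[OF e] openin_subset by blast
        hence "the (?A s \<tau>) e \<in> topspace (?C e)" if "\<tau> \<in> D" for \<tau>
          using that v[OF that] projc[OF that] cdom by (cases "\<tau> c = None") auto
        thus "(\<lambda>\<tau>. the (?A s \<tau>) e) \<in> topspace (subtopology ?K D) \<rightarrow> topspace (?C e)"
          by simp
      next
        fix W assume "openin (?C e) W"
        then consider (a) U where "openin X U" "W = Some ` U"
          | (b) C where "compactin (subtopology X (act_dom \<theta> e)) C"
              "W = insert None (Some ` (topspace (subtopology X (act_dom \<theta> e)) - C))"
          unfolding openin_Alexandroff_compactification openin_open_subtopology[OF opX[OF e]] by blast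
        hence "openin ?K {\<tau> \<in> D. the (?A s \<tau>) e \<in> W}"
        proof cases
          case a
          have "{\<tau> \<in> D. the (?A s \<tau>) e \<in> W} =
              {\<tau> \<in> D. \<tau> c \<noteq> None} \<inter> {\<tau> \<in> D. KS_proj \<tau> \<in> {x \<in> act_dom \<theta> d. the (\<theta> s x) \<in> U}}"
            using pd by (auto simp: a v split: if_splits)
          thus ?thesis using openin_Int[OF opc preD[OF preX[OF a(1)]]] by auto
        next
          case b
          have C: "compactin X C" "C \<subseteq> act_dom \<theta> e" using b(1) by (auto simp: compactin_subtopology)
          have Cc: "openin X (topspace X - C)"
            using compactin_imp_closedin[OF H C(1)] by (simp add: openin_diff)
          show ?thesis
          proof (subst openin_subopen, intro ballI)
            fix \<tau> assume "\<tau> \<in> {\<tau> \<in> D. the (?A s \<tau>) e \<in> W}"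
            hence \<tau>: "\<tau> \<in> D" "the (?A s \<tau>) e \<in> W" by auto
            let ?y = "the (\<theta> s (KS_proj \<tau>))"
            have inX: "the (\<theta> s x) \<in> topspace X" if "x \<in> act_dom \<theta> d" for x
              using that act_dom_star[OF A, of x s] sg_action_topspace[OF A] by (auto simp: d_def)
            show "\<exists>T. openin ?K T \<and> \<tau> \<in> T \<and> T \<subseteq> {\<tau> \<in> D. the (?A s \<tau>) e \<in> W}"
            proof (cases "?y \<in> C")
              case False
              let ?V = "{x \<in> act_dom \<theta> d. the (\<theta> s x) \<in> topspace X - C}"
              have "{\<tau> \<in> D. KS_proj \<tau> \<in> ?V} \<subseteq> {\<tau> \<in> D. the (?A s \<tau>) e \<in> W}"
              proof
                fix \<sigma> assume \<sigma>: "\<sigma> \<in> {\<tau> \<in> D. KS_proj \<tau> \<in> ?V}"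
                hence D: "\<sigma> \<in> D" by simp
                show "\<sigma> \<in> {\<tau> \<in> D. the (?A s \<tau>) e \<in> W}"
                  using \<sigma> v[OF D] projc[OF D] cdom by (cases "\<sigma> c = None") (auto simp: b(2))
              qed
              moreover have "\<tau> \<in> {\<tau> \<in> D. KS_proj \<tau> \<in> ?V}"
                using \<tau> False pd[OF \<tau>(1)] inX by auto
              moreover have "openin ?K {\<tau> \<in> D. KS_proj \<tau> \<in> ?V}"
                by (rule preD[OF preX[OF Cc]]) auto
              ultimately show ?thesis by blast
            next
              case True
              have N: "\<tau> c = None"
                using \<tau> True v[OF \<tau>(1)] by (auto simp: b(2) split: if_splits)
              have xc: "KS_proj \<tau> \<in> act_dom \<theta> c" using True C(2) pd[OF \<tau>(1)] cdom by auto
              have "locally_compact_space (subtopology X (act_dom \<theta> c))"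
                using locally_compact_space_open_subset[OF _ lc opX[OF c]] H by blast
              moreover have "KS_proj \<tau> \<in> topspace (subtopology X (act_dom \<theta> c))"
                using xc openin_subset[OF opX[OF c]] by auto
              ultimately obtain V K where "openin (subtopology X (act_dom \<theta> c)) V"
                  "compactin (subtopology X (act_dom \<theta> c)) K" and VK0: "KS_proj \<tau> \<in> V" "V \<subseteq> K"
                unfolding locally_compact_space_def by meson
              with VK0 have VK: "openin X V" "KS_proj \<tau> \<in> V" "V \<subseteq> K"
                  "compactin X K" "K \<subseteq> act_dom \<theta> c"
                by (auto simp: openin_open_subtopology[OF opX[OF c]] compactin_subtopology)
              have KC: "openin (?C c) (topspace (?C c) - Some ` K)"
              proof -
                have "compactin (subtopology X (act_dom \<theta> c)) K" using VK by (simp add: compactin_subtopology)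
                moreover have "Hausdorff_space (subtopology X (act_dom \<theta> c))"
                  by (rule Hausdorff_space_subtopology[OF H])
                ultimately have "closedin (?C c) (Some ` K)"
                  by (simp add: compactin_imp_closedin)
                thus ?thesis by (simp only: openin_diff openin_topspace)
              qed
              have Vd: "V \<subseteq> act_dom \<theta> d" using VK cdom by blast
              let ?T = "{\<tau> \<in> D. KS_proj \<tau> \<in> V} \<inter> {\<tau> \<in> topspace ?K. \<tau> c \<in> topspace (?C c) - Some ` K}"
              have "openin ?K ?T" by (intro openin_Int preD VK Vd op c KC)
              moreover have "\<tau> \<in> ?T" using \<tau> VK N DK by auto
              moreover have "?T \<subseteq> {\<tau> \<in> D. the (?A s \<tau>) e \<in> W}"
              proof
                fix \<sigma> assume \<sigma>: "\<sigma> \<in> ?T"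
                have "\<sigma> c = None"
                proof (rule ccontr)
                  assume "\<sigma> c \<noteq> None"
                  hence "\<sigma> c = Some (KS_proj \<sigma>)" using proj[of \<sigma> c] c \<sigma> by auto
                  thus False using \<sigma> VK(3) by auto
                qed
                thus "\<sigma> \<in> {\<tau> \<in> D. the (?A s \<tau>) e \<in> W}" using \<sigma> v[of \<sigma>] by (auto simp: b(2))
              qed
              ultimately show ?thesis by blast
            qed
          qed
        qed
        moreover have "{\<tau> \<in> topspace (subtopology ?K D). the (?A s \<tau>) e \<in> W} = {\<tau> \<in> D. the (?A s \<tau>) e \<in> W}"
          using DK by auto
        ultimately show "openin (subtopology ?K D) {\<tau> \<in> topspace (subtopology ?K D). the (?A s \<tau>) e \<in> W}"
          using openin_open_subtopology[OF Dop] by auto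
      qed
    qed
    have T: "\<tau> \<in> topspace (subtopology ?K D) \<Longrightarrow> the (?A s \<tau>) \<in> KS_dom X \<theta> (s * star s)" for \<tau>
      using val(1)[of \<tau> s] by (auto simp: D_def d_def)
    hence TK: "\<tau> \<in> topspace (subtopology ?K D) \<Longrightarrow> the (?A s \<tau>) \<in> topspace ?K" for \<tau>
      by (auto simp: KS_dom_def)
    have TE: "the (?A s \<tau>) \<in> KS_tilde X \<theta> - {KS_infty}" if "\<tau> \<in> topspace (subtopology ?K D)" for \<tau>
      using TK[OF that] KS_space_topspace by blast
    have ext: "the (?A s \<tau>) \<in> extensional idems" if "\<tau> \<in> topspace (subtopology ?K D)" for \<tau>
      using TE[OF that] by (auto simp: KS_tilde_def KS_product_def PiE_def)
    have "continuous_map (subtopology ?K D) (KS_product X \<theta>) (\<lambda>\<tau>. the (?A s \<tau>))"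
      unfolding KS_product_def continuous_map_componentwise using ext c1 by blast
    hence "continuous_map (subtopology ?K D) ?K (\<lambda>\<tau>. the (?A s \<tau>))"
      unfolding KS_space_def[of X \<theta>] using TE
      by (subst continuous_map_in_subtopology) (auto simp: KS_space_def)
    thus ?thesis
      using T by (subst continuous_map_in_subtopology) (auto simp: D_def d_def)
  qed
  have cover: "(\<Union>e\<in>idems. KS_dom X \<theta> e) = topspace ?K"
  proof
    show "topspace ?K \<subseteq> (\<Union>e\<in>idems. KS_dom X \<theta> e)"
    proof
      fix \<tau> assume "\<tau> \<in> topspace ?K"
      then obtain x F where P: "KS_pair \<theta> x F" and \<tau>: "\<tau> = KS_point x F"
        using KS_space_iff[OF A] by blast
      obtain e where "e \<in> F" "e \<in> idems" using P by (auto simp: KS_pair_def)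
      thus "\<tau> \<in> (\<Union>e\<in>idems. KS_dom X \<theta> e)" using KS_dom_point[OF A P] \<tau> by blast
    qed
  qed (auto simp: KS_dom_def)
  show ?thesis
    unfolding sg_action_def
    using Kpb KS_action_mult[OF A] dom_open cont cover
    by (simp add: KS_act_dom[OF A] star_mult_idem)
qed

end

theory Submission
  imports Defs
begin

text \<open>A point of \<open>X\<^sup>K\<^sup>S\<close> is a pair \<open>(x, F)\<close>, where \<open>F\<close> is a filter of idempotents \<open>e\<close> with
  \<open>x \<in> X\<^sub>e\<close>, and \<open>s\<close> moves it to \<open>(\<theta>\<^sub>s x, {e. s\<^sup>*es \<in> F})\<close>. In this picture \<open>p\<^sub>X\<close> forgets
  the filter, so its equivariance can be read off from the first component. The map
  \<open>\<iota>\<^sub>X\<close> attaches to \<open>x\<close> the largest possible filter \<open>{e. x \<in> X\<^sub>e}\<close>; since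
  \<open>x\<close> lies in the domain of \<open>s\<^sup>*es\<close> exactly when \<open>\<theta>\<^sub>s x\<close> is defined and lies in \<open>X\<^sub>e\<close>, the action carries
  the largest filter at \<open>x\<close> to the largest filter at \<open>\<theta>\<^sub>s x\<close>, which is the equivariance of \<open>\<iota>\<^sub>X\<close>.

  Continuity is a matter of coordinates. Each coordinate of \<open>\<iota>\<^sub>X\<close> collapses the complement of the
  open set \<open>X\<^sub>e\<close> to the point at infinity, which is continuous because compact subsets of the
  Hausdorff space \<open>X\<close> are closed. Conversely, on the open set \<open>X\<^sup>K\<^sup>S\<^sub>e\<close> the map \<open>p\<^sub>X\<close> is just the
  coordinate at \<open>e\<close>, and these sets cover \<open>X\<^sup>K\<^sup>S\<close>.\<close>

text \<open>An open set that misses the added point pulls back to itself. A neighbourhood of the added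
  point, given by a compact \<open>C \<subseteq> U\<close>, pulls back to the complement of \<open>C\<close> in all of \<open>X\<close>, and this
  is where the Hausdorff property is needed.\<close>

lemma continuous_map_collapse_complement:
  assumes H: "Hausdorff_space X" and U: "openin X U"
  shows "continuous_map X (Alexandroff_compactification (subtopology X U))
    (\<lambda>x. if x \<in> U then Some x else None)"
    (is "continuous_map X ?C ?f")
  unfolding continuous_map_def
proof (intro conjI allI impI)
  have UX: "U \<subseteq> topspace X" by (rule openin_subset[OF U])
  then show "?f \<in> topspace X \<rightarrow> topspace ?C" by auto
  fix W assume "openin ?C W"
  then consider (bounded) V where "openin X V" "V \<subseteq> U" "W = Some ` V"
    | (at_infinity) C where "compactin X C" "C \<subseteq> U" "W = insert None (Some ` (U - C))"
    using UX
    by (auto simp: openin_Alexandroff_compactification openin_open_subtopology[OF U]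
        compactin_subtopology Int_absorb1)
  then show "openin X {x \<in> topspace X. ?f x \<in> W}"
  proof cases
    case bounded
    then have "{x \<in> topspace X. ?f x \<in> W} = V" using UX by auto
    with bounded show ?thesis by simp
  next
    case at_infinity
    then have "{x \<in> topspace X. ?f x \<in> W} = topspace X - C" by auto
    with compactin_imp_closedin[OF H at_infinity(1)] show ?thesis
      by (simp add: openin_diff)
  qed
qed

text \<open>The filter that \<open>\<iota>\<^sub>X\<close> attaches to \<open>x\<close>: it is nonempty because the sets \<open>X\<^sub>e\<close> cover \<open>X\<close>, and
  the two closure conditions hold because \<open>\<theta>\<close> turns products into compositions.\<close>

lemma KS_pair_full_filter:
  assumes A: "sg_action X \<theta>" and x: "x \<in> topspace X"
  shows "KS_pair \<theta> x {e \<in> idems. x \<in> act_dom \<theta> e}"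
  unfolding KS_pair_def
proof (intro conjI ballI impI)
  show "{e \<in> idems. x \<in> act_dom \<theta> e} \<noteq> {}"
    using A x by (auto simp: sg_action_def)
next
  fix e f assume e: "e \<in> {e \<in> idems. x \<in> act_dom \<theta> e}" and f: "f \<in> idems" and fe: "f * e = e"
  have "\<theta> (f * e) x = Some x" using e fe by (simp add: act_dom_def)
  with e f show "f \<in> {e \<in> idems. x \<in> act_dom \<theta> e}"
    by (auto simp: sg_action_mult[OF A] act_dom_def)
next
  fix e f assume "e \<in> {e \<in> idems. x \<in> act_dom \<theta> e}" "f \<in> {e \<in> idems. x \<in> act_dom \<theta> e}"
  then show "e * f \<in> {e \<in> idems. x \<in> act_dom \<theta> e}"
    by (auto simp: sg_action_mult[OF A] act_dom_def idems_mult)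
qed auto

lemma KS_iota_eq_point: "KS_iota \<theta> x = KS_point x {e \<in> idems. x \<in> act_dom \<theta> e}"
  by (simp add: KS_iota_def KS_point_def restrict_def fun_eq_iff)

lemma KS_iota_in_space:
  assumes "sg_action X \<theta>" "x \<in> topspace X"
  shows "KS_iota \<theta> x \<in> topspace (KS_space X \<theta>)"
  unfolding KS_space_iff[OF assms(1)] KS_iota_eq_point
  by (intro exI conjI, rule KS_pair_full_filter[OF assms], rule refl)

lemma KS_iota_in_dom:
  assumes A: "sg_action X \<theta>" and x: "x \<in> topspace X" and e: "e \<in> idems"
  shows "KS_iota \<theta> x \<in> KS_dom X \<theta> e \<longleftrightarrow> x \<in> act_dom \<theta> e"
  using KS_dom_point[OF A KS_pair_full_filter[OF A x] e] e by (simp add: KS_iota_eq_point)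

lemma KS_proj_point:
  assumes P: "KS_pair \<theta> x F"
  shows "KS_proj (KS_point x F) = x"
  unfolding KS_proj_def
proof (rule the_equality)
  show "\<exists>e\<in>idems. KS_point x F e = Some x"
    using P by (auto simp: KS_pair_def KS_point_def)
qed (auto simp: KS_point_def split: if_splits)

lemma continuous_map_KS_iota:
  assumes H: "Hausdorff_space X" and A: "sg_action X \<theta>"
  shows "continuous_map X (KS_space X \<theta>) (KS_iota \<theta>)"
proof -
  have "continuous_map X (Alexandroff_compactification (subtopology X (act_dom \<theta> e)))
      (\<lambda>x. KS_iota \<theta> x e)" if e: "e \<in> idems" for e
  proof -
    have "openin X (act_dom \<theta> e)" using A e by (simp add: sg_action_def)
    from continuous_map_collapse_complement[OF H this] show ?thesis
      using e by (simp add: KS_iota_def)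
  qed
  then have "continuous_map X (KS_product X \<theta>) (KS_iota \<theta>)"
    unfolding KS_product_def continuous_map_componentwise by (auto simp: KS_iota_def)
  then show ?thesis
    using KS_iota_in_space[OF A] KS_space_topspace[of X \<theta>]
    by (auto simp: KS_space_def continuous_map_in_subtopology)
qed

text \<open>Since \<open>p\<^sub>X\<close> is locally a coordinate, the preimage of an open set \<open>V\<close> is the union over \<open>e\<close> of
  the sets where the coordinate at \<open>e\<close> lies in \<open>V \<inter> X\<^sub>e\<close>, which is open in the one-point
  compactification of \<open>X\<^sub>e\<close>.\<close>

lemma continuous_map_KS_proj:
  assumes A: "sg_action X \<theta>"
  shows "continuous_map (KS_space X \<theta>) X KS_proj"
  unfolding continuous_map_def
proof (intro conjI allI impI)
  let ?K = "KS_space X \<theta>"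
  have coord: "\<exists>e\<in>idems. \<tau> e = Some (KS_proj \<tau>) \<and> KS_proj \<tau> \<in> act_dom \<theta> e"
    if \<tau>: "\<tau> \<in> topspace ?K" for \<tau>
  proof -
    obtain x F where P: "KS_pair \<theta> x F" and x: "\<tau> = KS_point x F"
      using \<tau> KS_space_iff[OF A] by blast
    obtain e where "e \<in> F" "e \<in> idems" "x \<in> act_dom \<theta> e"
      using P by (auto simp: KS_pair_def)
    then show ?thesis using KS_proj_point[OF P] by (auto simp: x KS_point_def)
  qed
  have opX: "openin X (act_dom \<theta> e)" if "e \<in> idems" for e
    using A that by (simp add: sg_action_def)
  show "KS_proj \<in> topspace ?K \<rightarrow> topspace X"
    using coord opX openin_subset by blast
  fix V assume V: "openin X V"
  let ?N = "\<lambda>e. {\<tau> \<in> topspace ?K. \<tau> e \<in> Some ` (V \<inter> act_dom \<theta> e)}"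
  have "openin ?K (?N e)" if e: "e \<in> idems" for e
  proof (rule openin_continuous_map_preimage)
    show "continuous_map ?K (Alexandroff_compactification (subtopology X (act_dom \<theta> e))) (\<lambda>\<tau>. \<tau> e)"
      unfolding KS_space_def KS_product_def
      by (intro continuous_map_from_subtopology continuous_map_product_projection e)
    show "openin (Alexandroff_compactification (subtopology X (act_dom \<theta> e)))
        (Some ` (V \<inter> act_dom \<theta> e))"
      using V by (auto simp: openin_subtopology)
  qed
  moreover have "{\<tau> \<in> topspace ?K. KS_proj \<tau> \<in> V} = (\<Union>e\<in>idems. ?N e)"
  proof (intro equalityI subsetI)
    fix \<tau> assume "\<tau> \<in> {\<tau> \<in> topspace ?K. KS_proj \<tau> \<in> V}"
    then show "\<tau> \<in> (\<Union>e\<in>idems. ?N e)" using coord[of \<tau>] by auto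
  next
    fix \<tau> assume "\<tau> \<in> (\<Union>e\<in>idems. ?N e)"
    then obtain e x where "e \<in> idems" "\<tau> \<in> topspace ?K" "\<tau> e = Some x" "x \<in> V" by auto
    then show "\<tau> \<in> {\<tau> \<in> topspace ?K. KS_proj \<tau> \<in> V}"
      using KS_proj_eq[OF A, of \<tau> e] by auto
  qed
  ultimately show "openin ?K {\<tau> \<in> topspace ?K. KS_proj \<tau> \<in> V}"
    by auto
qed

text \<open>The point is that pushing the largest filter at \<open>x\<close> forward along \<open>s\<close> produces the
  largest filter at \<open>\<theta>\<^sub>s x\<close>, and nothing smaller.\<close>

lemma equivariant_KS_iota:
  fixes \<theta> :: "'s::inverse_semigroup \<Rightarrow> 'x \<rightharpoonup> 'x"
  assumes A: "sg_action X \<theta>" and K: "sg_action (KS_space X \<theta>) (KS_action X \<theta>)"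
  shows "equivariant X \<theta> (KS_space X \<theta>) (KS_action X \<theta>) (KS_iota \<theta>)"
  unfolding equivariant_def
proof (intro conjI ballI allI A K)
  show "KS_iota \<theta> \<in> topspace X \<rightarrow> topspace (KS_space X \<theta>)"
    using KS_iota_in_space[OF A] by blast
next
  fix e :: 's assume e: "e \<in> idems"
  have "act_dom \<theta> e \<subseteq> topspace X" using A e by (auto simp: sg_action_def)
  then show "KS_iota \<theta> ` act_dom \<theta> e \<subseteq> act_dom (KS_action X \<theta>) e"
    unfolding KS_act_dom[OF A e] using KS_iota_in_dom[OF A _ e] by blast
next
  fix s x assume x: "x \<in> act_dom \<theta> (star s * s)"
  obtain y where y: "\<theta> s x = Some y" using x act_dom_star[OF A] by blast
  have xX: "x \<in> topspace X" by (rule sg_action_topspace(1)[OF A y])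
  let ?F = "\<lambda>x. {e \<in> idems. x \<in> act_dom \<theta> e}"
  have "KS_push s (?F x) = ?F y"
    using y by (auto simp: KS_push_def conj_idem act_dom_conj[OF A])
  then show "KS_iota \<theta> (the (\<theta> s x)) = the (KS_action X \<theta> s (KS_iota \<theta> x))"
    using x y KS_action_point[OF A KS_pair_full_filter[OF A xX], of s]
    by (simp add: KS_iota_eq_point star_mult_idem)
qed

lemma equivariant_KS_proj:
  assumes A: "sg_action X \<theta>" and K: "sg_action (KS_space X \<theta>) (KS_action X \<theta>)"
  shows "equivariant (KS_space X \<theta>) (KS_action X \<theta>) X \<theta> KS_proj"
  unfolding equivariant_def
proof (intro conjI ballI allI A K)
  show "KS_proj \<in> topspace (KS_space X \<theta>) \<rightarrow> topspace X"
    using continuous_map_KS_proj[OF A] by (simp add: continuous_map_def)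
  have point: "\<exists>x F. KS_pair \<theta> x F \<and> \<tau> = KS_point x F \<and> e \<in> F"
    if e: "e \<in> idems" and \<tau>: "\<tau> \<in> act_dom (KS_action X \<theta>) e" for e \<tau>
  proof -
    have d: "\<tau> \<in> KS_dom X \<theta> e" using \<tau> KS_act_dom[OF A e] by simp
    then obtain x F where P: "KS_pair \<theta> x F" and x: "\<tau> = KS_point x F"
      using KS_space_iff[OF A] by (auto simp: KS_dom_def)
    then show ?thesis using d KS_dom_point[OF A P e] by blast
  qed
  show "KS_proj ` act_dom (KS_action X \<theta>) e \<subseteq> act_dom \<theta> e" if e: "e \<in> idems" for e
  proof
    fix z assume "z \<in> KS_proj ` act_dom (KS_action X \<theta>) e"
    then obtain x F where P: "KS_pair \<theta> x F" and "e \<in> F" and z: "z = KS_proj (KS_point x F)"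
      using point[OF e] by blast
    then have "x \<in> act_dom \<theta> e" by (simp add: KS_pair_def)
    then show "z \<in> act_dom \<theta> e" by (simp add: z KS_proj_point[OF P])
  qed
  fix s \<tau> assume "\<tau> \<in> act_dom (KS_action X \<theta>) (star s * s)"
  then obtain x F where P: "KS_pair \<theta> x F" and \<tau>: "\<tau> = KS_point x F" and F: "star s * s \<in> F"
    using point[OF star_mult_idem(1)] by blast
  show "KS_proj (the (KS_action X \<theta> s \<tau>)) = the (\<theta> s (KS_proj \<tau>))"
    using KS_proj_point[OF KS_push_pair[OF A P F]] KS_action_point[OF A P, of s] F
    by (simp add: \<tau> KS_proj_point[OF P])
qed

theorem proposition2p2p7:
  fixes X :: "'x topology"
    and \<theta> :: "'s::inverse_semigroup \<Rightarrow> 'x \<rightharpoonup> 'x"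
  assumes "locally_compact_space X" and "Hausdorff_space X"
    and "sg_action X \<theta>"
  shows "(continuous_map X (KS_space X \<theta>) (KS_iota \<theta>) \<and>
          equivariant X \<theta> (KS_space X \<theta>) (KS_action X \<theta>) (KS_iota \<theta>) \<and>
          (\<forall>e\<in>idems. KS_iota \<theta> ` act_dom \<theta> e = KS_dom X \<theta> e \<inter> KS_iota \<theta> ` topspace X)) \<and>
         (continuous_map (KS_space X \<theta>) X KS_proj \<and>
          equivariant (KS_space X \<theta>) (KS_action X \<theta>) X \<theta> KS_proj)"
proof -
  note A = assms(3)
  have K: "sg_action (KS_space X \<theta>) (KS_action X \<theta>)"
    by (rule KS_action_sg_action[OF assms])
  have "KS_iota \<theta> ` act_dom \<theta> e = KS_dom X \<theta> e \<inter> KS_iota \<theta> ` topspace X"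
    if e: "e \<in> idems" for e
  proof -
    have "act_dom \<theta> e \<subseteq> topspace X" using A e by (auto simp: sg_action_def)
    then show ?thesis using KS_iota_in_dom[OF A _ e] by blast
  qed
  then show ?thesis
    using continuous_map_KS_iota[OF assms(2) A] equivariant_KS_iota[OF A K]
      continuous_map_KS_proj[OF A] equivariant_KS_proj[OF A K]
    by blast
qed

end
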